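(* Let $Z$ be a clean NROBP computing a Boolean function on $n$ variables and having $q$ irregular edges. Then there is a uniform NROBP $Z^*$ computing the same function as $Z$ and having at most $2qn$ more edges than $Z$.
   Context: An NROBP computing $F$ is a finite DAG (multiple edges allowed) with one root and one leaf, some edges labelled by literals of variables of $F$, with no directed path containing two edges labelled by literals of the same variable; for a path $P$, $A(P)$ is its set of edge labels; it computes $F$ if every total assignment containing $A(P)$ for a root-leaf path $P$ satisfies $F$, and every satisfying assignment of $F$ contains $A(P)$ for some root-leaf path $P$. It is uniform if for every node $a$ any two root-to-$a$ paths use literals of the same variable set and every root-leaf path uses literals of all variables of $F$. The in-degree $d^+(v)$ of a node $v$ is its number of in-neighbours. The NROBP is clean if all in-coming edges of nodes $v$ with $d^+(v)>1$ are unlabelled. For a node $v$, $IVar(v)$ is the set of variables $x$ such that a literal of $x$ labels an edge on some path from the root to $v$. An edge $(u,v)$ is relevant if $d^+(v)>1$; a relevant edge $(u,v)$ is irregular if $IVar(u) \subsetneq IVar(v)$, and regular otherwise.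
   Formalization: If q = 0, every one of the n variables is assumed to label some edge of Z (otherwise F = x1 on {x1,x2} with a single edge is a counterexample); the in-degree counts parallel edges with multiplicity (otherwise two parallel edges labelled x and y are a counterexample). *)

theory Defs
  imports Graph_Theory.Graph_Theory
begin

text \<open>
  The literal \<open>(x, True)\<close> is the positive literal of \<open>x\<close> and \<open>(x, False)\<close> the negative one.
  A total assignment to \<open>V\<close> is a map with domain \<open>V\<close>; the set of literals it contains is its
  \<^const>\<open>Map.graph\<close>. A Boolean function on \<open>V\<close> is given by \<open>F :: ('x \<rightharpoonup> bool) \<Rightarrow> bool\<close>, of which
  only the values on total assignments to \<open>V\<close> are used.
\<close>

type_synonym 'x literal = "'x \<times> bool"

record ('v, 'e, 'x) bprog =
  dg :: "('v, 'e) pre_digraph"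
  label :: "'e \<Rightarrow> 'x literal option"

abbreviation nodes :: "('v, 'e, 'x) bprog \<Rightarrow> 'v set" where
  "nodes Z \<equiv> verts (dg Z)"

abbreviation edges :: "('v, 'e, 'x) bprog \<Rightarrow> 'e set" where
  "edges Z \<equiv> arcs (dg Z)"

abbreviation path :: "('v, 'e, 'x) bprog \<Rightarrow> 'v \<Rightarrow> 'e list \<Rightarrow> 'v \<Rightarrow> bool" where
  "path Z \<equiv> pre_digraph.apath (dg Z)"

definition labels :: "('v, 'e, 'x) bprog \<Rightarrow> 'e set \<Rightarrow> 'x literal set" where
  "labels Z E = {l. \<exists>e\<in>E. label Z e = Some l}"

definition label_vars :: "('v, 'e, 'x) bprog \<Rightarrow> 'e set \<Rightarrow> 'x set" where
  "label_vars Z E = fst ` labels Z E"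

text \<open>
  Multiple edges are allowed, so in-neighbours are counted with multiplicity, as
  \<^const>\<open>in_degree\<close> does: two parallel edges into \<open>v\<close> give \<open>v\<close> in-degree 2.
\<close>

definition is_root :: "('v, 'e, 'x) bprog \<Rightarrow> 'v \<Rightarrow> bool" where
  "is_root Z v \<longleftrightarrow> v \<in> nodes Z \<and> in_degree (dg Z) v = 0"

definition is_leaf :: "('v, 'e, 'x) bprog \<Rightarrow> 'v \<Rightarrow> bool" where
  "is_leaf Z v \<longleftrightarrow> v \<in> nodes Z \<and> out_degree (dg Z) v = 0"

text \<open>Used only when the root and the leaf exist and are unique, as in \<open>nrobp\<close> below.\<close>

definition root :: "('v, 'e, 'x) bprog \<Rightarrow> 'v" where
  "root Z = (THE v. is_root Z v)"

definition leaf :: "('v, 'e, 'x) bprog \<Rightarrow> 'v" where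
  "leaf Z = (THE v. is_leaf Z v)"

definition read_once :: "('v, 'e, 'x) bprog \<Rightarrow> bool" where
  "read_once Z \<longleftrightarrow>
     (\<forall>u p v. path Z u p v \<longrightarrow>
       (\<forall>e\<in>set p. \<forall>e'\<in>set p. \<forall>x b b'.
          label Z e = Some (x, b) \<and> label Z e' = Some (x, b') \<longrightarrow> e = e'))"

definition nrobp :: "'x set \<Rightarrow> ('v, 'e, 'x) bprog \<Rightarrow> bool" where
  "nrobp V Z \<longleftrightarrow>
     fin_digraph (dg Z) \<and>
     (\<nexists>c. pre_digraph.cycle (dg Z) c) \<and>
     (\<exists>!v. is_root Z v) \<and>
     (\<exists>!v. is_leaf Z v) \<and>
     label_vars Z (edges Z) \<subseteq> V \<and>
     read_once Z"

definition computes ::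
  "('v, 'e, 'x) bprog \<Rightarrow> 'x set \<Rightarrow> (('x \<rightharpoonup> bool) \<Rightarrow> bool) \<Rightarrow> bool" where
  "computes Z V F \<longleftrightarrow>
     (\<forall>P \<alpha>. path Z (root Z) P (leaf Z) \<and> dom \<alpha> = V \<and> labels Z (set P) \<subseteq> Map.graph \<alpha> \<longrightarrow> F \<alpha>) \<and>
     (\<forall>\<alpha>. dom \<alpha> = V \<and> F \<alpha> \<longrightarrow>
        (\<exists>P. path Z (root Z) P (leaf Z) \<and> labels Z (set P) \<subseteq> Map.graph \<alpha>))"

definition uniform :: "'x set \<Rightarrow> ('v, 'e, 'x) bprog \<Rightarrow> bool" where
  "uniform V Z \<longleftrightarrow>
     (\<forall>a\<in>nodes Z. \<forall>P Q. path Z (root Z) P a \<and> path Z (root Z) Q a \<longrightarrow>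
        label_vars Z (set P) = label_vars Z (set Q)) \<and>
     (\<forall>P. path Z (root Z) P (leaf Z) \<longrightarrow> label_vars Z (set P) = V)"

definition clean :: "('v, 'e, 'x) bprog \<Rightarrow> bool" where
  "clean Z \<longleftrightarrow>
     (\<forall>v\<in>nodes Z. in_degree (dg Z) v > 1 \<longrightarrow> (\<forall>e\<in>in_arcs (dg Z) v. label Z e = None))"

definition IVar :: "('v, 'e, 'x) bprog \<Rightarrow> 'v \<Rightarrow> 'x set" where
  "IVar Z v = {x. \<exists>P. path Z (root Z) P v \<and> x \<in> label_vars Z (set P)}"

definition relevant :: "('v, 'e, 'x) bprog \<Rightarrow> 'e \<Rightarrow> bool" where
  "relevant Z e \<longleftrightarrow> e \<in> edges Z \<and> in_degree (dg Z) (head (dg Z) e) > 1"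

definition irregular :: "('v, 'e, 'x) bprog \<Rightarrow> 'e \<Rightarrow> bool" where
  "irregular Z e \<longleftrightarrow>
     relevant Z e \<and> IVar Z (tail (dg Z) e) \<subset> IVar Z (head (dg Z) e)"

end

theory Submission
  imports Defs Complex_Main
begin

text \<open>
  If every edge \<open>(u, v)\<close> satisfies \<open>IVar u = IVar v\<close> when it is unlabelled and
  \<open>IVar v = insert x (IVar u)\<close> with \<open>x \<notin> IVar u\<close> when it is labelled by a literal of \<open>x\<close>, then all
  paths from the root to \<open>v\<close> read exactly \<open>IVar v\<close>. In a clean program only irregular edges violate
  this, and they are unlabelled. A missing variable \<open>x\<close> is read by inserting in front of such an edge
  a pair of parallel edges labelled by the two literals of \<open>x\<close>, and each variable missing at the leaf
  by such a pair appended to the leaf. For \<open>m = card (IVar leaf)\<close> this needs at most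
  \<open>q * m + (n - m)\<close> pairs, which is at most \<open>q * n\<close> if \<open>q \<ge> 1\<close>; if \<open>q = 0\<close> nothing is missing.
\<close>

section \<open>Acceptance as reachability, and the variables missing along edges\<close>

text \<open>As a relation on nodes this forgets edge names and multiplicities. Acceptance becomes
  plain reachability, and a change of the program can be checked one step at a time, without
  transforming paths.\<close>

definition open_steps :: "('v, 'e, 'x) bprog \<Rightarrow> ('x \<rightharpoonup> bool) \<Rightarrow> ('v \<times> 'v) set" where
  "open_steps Z \<alpha> =
     {(tail (dg Z) e, head (dg Z) e) |e. e \<in> edges Z \<and> labels Z {e} \<subseteq> Map.graph \<alpha>}"

definition accepts ::
  "('v, 'e, 'x) bprog \<Rightarrow> 'v \<Rightarrow> 'v \<Rightarrow> ('x \<rightharpoonup> bool) \<Rightarrow> bool" where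
  "accepts Z r t \<alpha> \<longleftrightarrow> (r, t) \<in> (open_steps Z \<alpha>)\<^sup>*"

text \<open>Each gap will cost one pair of new edges, so this set serves both as induction measure
  and as edge count. Labelled edges are left out because \<open>grade_labelled\<close> below makes
  them exact.\<close>

definition gaps :: "('v, 'e, 'x) bprog \<Rightarrow> ('v \<Rightarrow> 'x set) \<Rightarrow> ('e \<times> 'x) set" where
  "gaps Z I = {(e, x). e \<in> edges Z \<and> label Z e = None \<and>
     x \<in> I (head (dg Z) e) - I (tail (dg Z) e)}"

text \<open>
  \<open>I v\<close> is to become the set of variables read on every path from the root to \<open>v\<close>; it is so once there
  are no gaps. The rank \<open>f\<close> witnesses acyclicity and is real-valued to leave room for new nodes.
\<close>

locale graded_bprog = fin_digraph "dg Z"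
  for Z :: "('v, 'e, 'x) bprog" +
  fixes V :: "'x set" and r t :: 'v and I :: "'v \<Rightarrow> 'x set" and f :: "'v \<Rightarrow> real"
  assumes finite_V: "finite V"
    and root_node: "r \<in> nodes Z" and leaf_node: "t \<in> nodes Z"
    and no_arc_to_root: "e \<in> edges Z \<Longrightarrow> head (dg Z) e \<noteq> r"
    and no_arc_from_leaf: "e \<in> edges Z \<Longrightarrow> tail (dg Z) e \<noteq> t"
    and arc_to_nonroot: "v \<in> nodes Z \<Longrightarrow> v \<noteq> r \<Longrightarrow> \<exists>e\<in>edges Z. head (dg Z) e = v"
    and arc_from_nonleaf: "v \<in> nodes Z \<Longrightarrow> v \<noteq> t \<Longrightarrow> \<exists>e\<in>edges Z. tail (dg Z) e = v"
    and rank: "e \<in> edges Z \<Longrightarrow> f (tail (dg Z) e) < f (head (dg Z) e)"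
    and grade_root: "I r = {}"
    and grade_le: "v \<in> nodes Z \<Longrightarrow> I v \<subseteq> V"
    and grade_unlabelled:
      "e \<in> edges Z \<Longrightarrow> label Z e = None \<Longrightarrow> I (tail (dg Z) e) \<subseteq> I (head (dg Z) e)"
    and grade_labelled:
      "e \<in> edges Z \<Longrightarrow> label Z e = Some (x, b) \<Longrightarrow>
       x \<notin> I (tail (dg Z) e) \<and> I (head (dg Z) e) = insert x (I (tail (dg Z) e))"

section \<open>Label sets, roots, leaves and walks\<close>

lemma labels_empty [simp]: "labels Z {} = {}"
  by (auto simp: labels_def)

lemma labels_insert: "labels Z (insert e E) = labels Z {e} \<union> labels Z E"
  by (auto simp: labels_def)

lemma label_vars_empty [simp]: "label_vars Z {} = {}"
  by (auto simp: label_vars_def)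

lemma label_vars_insert: "label_vars Z (insert e E) = label_vars Z {e} \<union> label_vars Z E"
  by (auto simp: label_vars_def labels_insert[of Z e E])

lemma label_vars_Un: "label_vars Z (A \<union> B) = label_vars Z A \<union> label_vars Z B"
  by (auto simp: label_vars_def labels_def)

lemma label_vars_single:
  "label_vars Z {e} = (case label Z e of None \<Rightarrow> {} | Some l \<Rightarrow> {fst l})"
  by (auto simp: label_vars_def labels_def split: option.splits)

lemma labels_single: "labels Z {e} = set_option (label Z e)"
  by (auto simp: labels_def)

text \<open>Finiteness matters here: \<open>in_degree\<close> is a cardinality and would also be 0
  for an infinite set of incoming edges.\<close>

lemma is_root_iff:
  assumes "fin_digraph (dg Z)"
  shows "is_root Z v \<longleftrightarrow> v \<in> nodes Z \<and> (\<forall>e\<in>edges Z. head (dg Z) e \<noteq> v)"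
  using fin_digraph.finite_in_arcs[OF assms, of v]
  by (auto simp: is_root_def in_degree_def in_arcs_def)

lemma is_leaf_iff:
  assumes "fin_digraph (dg Z)"
  shows "is_leaf Z v \<longleftrightarrow> v \<in> nodes Z \<and> (\<forall>e\<in>edges Z. tail (dg Z) e \<noteq> v)"
  using fin_digraph.finite_out_arcs[OF assms, of v]
  by (auto simp: is_leaf_def out_degree_def out_arcs_def)

text \<open>A repeated node would split off a nonempty closed walk, and such a walk yields a cycle.
  Walks can be extended and concatenated freely, so the proofs below use them instead of
  paths.\<close>

lemma (in wf_digraph) apath_iff_awalk_of_acyclic:
  assumes "\<nexists>c. cycle c"
  shows "apath u p v \<longleftrightarrow> awalk u p v"
proof
  assume p: "awalk u p v"
  have "distinct (awalk_verts u p)"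
    using awalk_not_distinct_decomp[OF p] closed_w_imp_cycle assms
    by (metis closed_w_def length_greater_0_conv)
  with p show "apath u p v" by (simp add: apath_def)
qed (simp add: apath_def)

text \<open>Induction along the closure in one direction and along the walk in the other. The
  condition on \<open>u\<close> is for the empty walk, since the reflexive closure relates any
  \<open>u\<close> to itself.\<close>

lemma accepts_iff_awalk:
  assumes "wf_digraph (dg Z)" and "u \<in> nodes Z"
  shows "accepts Z u v \<alpha> \<longleftrightarrow>
    (\<exists>p. pre_digraph.awalk (dg Z) u p v \<and> labels Z (set p) \<subseteq> Map.graph \<alpha>)"
proof -
  interpret wf_digraph "dg Z" by fact
  have "(u, v) \<in> (open_steps Z \<alpha>)\<^sup>* \<Longrightarrow> u \<in> nodes Z \<Longrightarrow>
    \<exists>p. awalk u p v \<and> labels Z (set p) \<subseteq> Map.graph \<alpha>"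
  proof (induction rule: converse_rtrancl_induct)
    case base
    then show ?case by (intro exI[of _ "[]"]) (simp add: awalk_Nil_iff)
  next
    case (step y z)
    then obtain e where e: "e \<in> edges Z" "labels Z {e} \<subseteq> Map.graph \<alpha>"
      "y = tail (dg Z) e" "z = head (dg Z) e"
      by (auto simp: open_steps_def)
    with step obtain p where "awalk z p v" "labels Z (set p) \<subseteq> Map.graph \<alpha>"
      by auto
    with e have "awalk y (e # p) v" "labels Z (set (e # p)) \<subseteq> Map.graph \<alpha>"
      by (auto simp: awalk_Cons_iff labels_insert[of Z e "set p"])
    then show ?case by blast
  qed
  moreover have "awalk u p v \<Longrightarrow> labels Z (set p) \<subseteq> Map.graph \<alpha> \<Longrightarrow>
    (u, v) \<in> (open_steps Z \<alpha>)\<^sup>*" for p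
  proof (induction p arbitrary: u)
    case (Cons e p)
    then have "(head (dg Z) e, v) \<in> (open_steps Z \<alpha>)\<^sup>*" "(u, head (dg Z) e) \<in> open_steps Z \<alpha>"
      by (auto simp: awalk_Cons_iff labels_insert[of Z e "set p"] open_steps_def)
    then show ?case by (rule converse_rtrancl_into_rtrancl[rotated])
  qed (simp add: awalk_Nil_iff)
  ultimately show ?thesis
    using assms(2) by (auto simp: accepts_def)
qed

lemma computes_iff_accepts:
  assumes "wf_digraph (dg Z)" and "\<nexists>c. pre_digraph.cycle (dg Z) c" and "root Z \<in> nodes Z"
  shows "computes Z V F \<longleftrightarrow> (\<forall>\<alpha>. dom \<alpha> = V \<longrightarrow> (F \<alpha> \<longleftrightarrow> accepts Z (root Z) (leaf Z) \<alpha>))"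
  unfolding computes_def accepts_iff_awalk[OF assms(1,3)]
    wf_digraph.apath_iff_awalk_of_acyclic[OF assms(1,2)]
  by blast

text \<open>One step may be matched by none or by several: an inserted edge is collapsed in one
  direction, a redirected edge becomes two steps in the other.\<close>

lemma rtrancl_simulation:
  assumes "(x, y) \<in> A\<^sup>*" and "\<And>x y. (x, y) \<in> A \<Longrightarrow> (g x, g y) \<in> B\<^sup>*"
  shows "(g x, g y) \<in> B\<^sup>*"
  using assms(1) by induction (auto intro: rtrancl_trans assms(2))

section \<open>Graded programs are NROBPs, and uniform ones once nothing is missing\<close>

context graded_bprog
begin

lemma rank_awalk: "awalk u p v \<Longrightarrow> p \<noteq> [] \<Longrightarrow> f u < f v"
proof (induction p arbitrary: u)
  case (Cons e p)
  then show ?case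
    using rank[of e] by (cases "p = []") (fastforce simp: awalk_Cons_iff awalk_Nil_iff)+
qed simp

lemma acyclic: "\<nexists>c. cycle c"
  using rank_awalk by (auto simp: cycle_def)

lemma path_iff: "path Z u p v \<longleftrightarrow> awalk u p v"
  by (rule apath_iff_awalk_of_acyclic[OF acyclic])

lemma is_root_iff_eq: "is_root Z v \<longleftrightarrow> v = r"
  using is_root_iff[OF fin_digraph_axioms] root_node no_arc_to_root arc_to_nonroot by metis

lemma is_leaf_iff_eq: "is_leaf Z v \<longleftrightarrow> v = t"
  using is_leaf_iff[OF fin_digraph_axioms] leaf_node no_arc_from_leaf arc_from_nonleaf by metis

lemma root_eq: "root Z = r"
  by (simp add: root_def is_root_iff_eq)

lemma leaf_eq: "leaf Z = t"
  by (simp add: leaf_def is_leaf_iff_eq)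

lemma grade_mono_arc: "e \<in> edges Z \<Longrightarrow> I (tail (dg Z) e) \<subseteq> I (head (dg Z) e)"
  using grade_unlabelled grade_labelled by (cases "label Z e") fastforce+

lemma label_vars_arc:
  "e \<in> edges Z \<Longrightarrow> label_vars Z {e} \<subseteq> I (head (dg Z) e) - I (tail (dg Z) e)"
  using grade_labelled[of e] by (auto simp: label_vars_single split: option.splits)

text \<open>Subtracting \<open>I u\<close> is the point: whatever a walk reads is new relative to
  the grade at its start, which yields the read-once property.\<close>

lemma label_vars_awalk:
  "awalk u p v \<Longrightarrow> I u \<subseteq> I v \<and> label_vars Z (set p) \<subseteq> I v - I u"
proof (induction p arbitrary: u)
  case (Cons e p)
  then have "e \<in> edges Z" "u = tail (dg Z) e" "awalk (head (dg Z) e) p v"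
    by (simp_all add: awalk_Cons_iff)
  with grade_mono_arc[of e] label_vars_arc[of e] Cons.IH[of "head (dg Z) e"] show ?case
    unfolding list.set label_vars_insert[of Z e "set p"] by blast
qed (simp add: awalk_Nil_iff)

lemma read_once: "read_once Z"
proof -
  have "e = e'"
    if "awalk u p v" "e \<in> set p" "e' \<in> set p" "label Z e = Some (x, b)" "label Z e' = Some (x, b')"
    for u p v e e' x b b'
    using that
  proof (induction p arbitrary: u)
    case (Cons a p)
    have later: "x \<notin> label_vars Z (set p)" if "x \<in> label_vars Z {a}"
      using Cons.prems(1) label_vars_arc[of a] label_vars_awalk[of "head (dg Z) a" p v] that
      by (auto simp: awalk_Cons_iff)
    have "x \<in> label_vars Z {e}" "x \<in> label_vars Z {e'}"
      using Cons.prems by (auto simp: label_vars_single)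
    moreover have "label_vars Z {d} \<subseteq> label_vars Z (set p)" if "d \<in> set p" for d
      using that by (auto simp: label_vars_def labels_def)
    \<comment> \<open>If one of the two edges is the first edge \<open>a\<close>, then
      \<open>later\<close> keeps x off the rest of the walk and the other is \<open>a\<close> as
      well. Otherwise both lie in \<open>p\<close>, where the induction hypothesis applies.\<close>
    ultimately have "e = a \<and> e' = a \<or> e \<in> set p \<and> e' \<in> set p"
      using Cons.prems(2,3) later by auto
    then show ?case using Cons by (auto simp: awalk_Cons_iff)
  qed simp
  then show ?thesis unfolding read_once_def path_iff by blast
qed

lemma nrobp: "nrobp V Z"
proof -
  have "label_vars Z {e} \<subseteq> V" if "e \<in> edges Z" for e
    using label_vars_arc[OF that] grade_le[OF head_in_verts[OF that]] by blast
  then have "label_vars Z (edges Z) \<subseteq> V"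
    by (force simp: label_vars_def labels_def)
  then show ?thesis
    using acyclic read_once fin_digraph_axioms
    by (simp add: nrobp_def is_root_iff_eq is_leaf_iff_eq)
qed

text \<open>Without gaps an unlabelled edge leaves the grade unchanged and a labelled one adds just
  its variable, so the grade records exactly what has been read.\<close>

lemma label_vars_awalk_eq:
  assumes "gaps Z I = {}"
  shows "awalk u p v \<Longrightarrow> I v = I u \<union> label_vars Z (set p)"
proof (induction p arbitrary: u)
  case (Cons e p)
  then have e: "e \<in> edges Z" by (simp add: awalk_Cons_iff)
  have "I (head (dg Z) e) = I (tail (dg Z) e) \<union> label_vars Z {e}"
  proof (cases "label Z e")
    case None
    then show ?thesis
      using assms e grade_mono_arc[OF e] by (fastforce simp: gaps_def label_vars_single)
  next
    case (Some l)
    then show ?thesis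
      using grade_labelled[OF e, of "fst l" "snd l"] by (auto simp: label_vars_single)
  qed
  then show ?case
    using Cons by (auto simp: awalk_Cons_iff label_vars_insert[of Z e "set p"])
qed (simp add: awalk_Nil_iff)

lemma uniform:
  assumes "gaps Z I = {}" and "I t = V"
  shows "uniform V Z"
proof -
  have "label_vars Z (set p) = I v" if "awalk r p v" for p v
    using label_vars_awalk_eq[OF assms(1) that] by (simp add: grade_root)
  then show ?thesis
    using assms(2) unfolding uniform_def path_iff root_eq leaf_eq by metis
qed

lemma computes_iff:
  "computes Z V F \<longleftrightarrow> (\<forall>\<alpha>. dom \<alpha> = V \<longrightarrow> (F \<alpha> \<longleftrightarrow> accepts Z r t \<alpha>))"
  using computes_iff_accepts[OF wf_digraph acyclic] root_node by (simp add: root_eq leaf_eq)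

lemma finite_gaps: "finite (gaps Z I)"
proof (rule finite_subset)
  show "gaps Z I \<subseteq> edges Z \<times> V"
    using grade_le head_in_verts by (fastforce simp: gaps_def)
qed (simp add: finite_V)

end

section \<open>Inserting pairs of edges that read a missing variable\<close>

text \<open>The edge \<open>e\<close> is redirected to start at a new node \<open>w\<close>, and two
  parallel edges from its old tail \<open>u\<close> to \<open>w\<close> read x. With grade
  \<open>insert x (I u)\<close> at \<open>w\<close> the pair is exact, and \<open>e\<close> misses
  the same variables as before except x. A total assignment opens one edge of the pair, so
  acceptance is unchanged.\<close>

lemma graded_bprog_fill_gap:
  fixes Z :: "(nat, nat, 'x) bprog"
  assumes "graded_bprog Z V r t I f" and gap: "(e, x) \<in> gaps Z I"
  obtains Z' :: "(nat, nat, 'x) bprog" and I' f'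
  where "graded_bprog Z' V r t I' f'"
    and "\<And>\<alpha>. dom \<alpha> = V \<Longrightarrow> accepts Z' r t \<alpha> \<longleftrightarrow> accepts Z r t \<alpha>"
    and "card (edges Z') = card (edges Z) + 2"
    and "gaps Z' I' = gaps Z I - {(e, x)}" and "I' t = I t"
proof -
  interpret graded_bprog Z V r t I f by fact
  define u v where "u = tail (dg Z) e" and "v = head (dg Z) e"
  have e: "e \<in> edges Z" "label Z e = None" "x \<in> I v" "x \<notin> I u"
    using gap by (auto simp: gaps_def u_def v_def)
  have uv: "u \<in> nodes Z" "v \<in> nodes Z" "I u \<subseteq> I v" "f u < f v" "u \<noteq> t" "v \<noteq> r"
    using e grade_unlabelled[of e] rank[of e] no_arc_to_root[of e] no_arc_from_leaf[of e]
    by (auto simp: u_def v_def)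
  obtain w where w: "w \<notin> nodes Z"
    using ex_new_if_finite[OF infinite_UNIV_nat finite_verts] by blast
  obtain a where a: "a \<notin> edges Z"
    using ex_new_if_finite[OF infinite_UNIV_nat finite_arcs] by blast
  obtain b where b: "b \<notin> edges Z" "b \<noteq> a"
    using ex_new_if_finite[OF infinite_UNIV_nat, of "insert a (edges Z)"] by auto
  define Z' :: "(nat, nat, 'x) bprog" where
    "Z' = \<lparr>dg = \<lparr>verts = insert w (nodes Z), arcs = insert a (insert b (edges Z)),
        tail = (tail (dg Z))(e := w, a := u, b := u), head = (head (dg Z))(a := w, b := w)\<rparr>,
      label = (label Z)(a := Some (x, True), b := Some (x, False))\<rparr>"
  define I' where "I' = I(w := insert x (I u))"
  define f' where "f' = f(w := (f u + f v) / 2)"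
  have old: "tail (dg Z) d \<noteq> w" "head (dg Z) d \<noteq> w" "d \<noteq> a" "d \<noteq> b" if "d \<in> edges Z" for d
    using that w a b by (auto dest: tail_in_verts head_in_verts)
  have ne: "e \<noteq> a" "e \<noteq> b" "w \<noteq> u" "w \<noteq> v" "w \<noteq> r" "w \<noteq> t"
    using e uv a b w root_node leaf_node by auto
  have tl: "tail (dg Z') d = (if d = e then w else tail (dg Z) d)"
    and hd: "head (dg Z') d = head (dg Z) d"
    and lb: "label Z' d = label Z d" if "d \<in> edges Z" for d
    using old[OF that] by (auto simp: Z'_def)
  have new: "tail (dg Z') a = u" "tail (dg Z') b = u" "head (dg Z') a = w" "head (dg Z') b = w"
    "label Z' a = Some (x, True)" "label Z' b = Some (x, False)"
    using b by (auto simp: Z'_def)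
  have sets: "nodes Z' = insert w (nodes Z)" "edges Z' = insert a (insert b (edges Z))"
    by (auto simp: Z'_def)
  have I': "I' w = insert x (I u)" "\<And>z. z \<noteq> w \<Longrightarrow> I' z = I z"
    and f': "f' w = (f u + f v) / 2" "\<And>z. z \<noteq> w \<Longrightarrow> f' z = f z"
    by (auto simp: I'_def f'_def)
  have "graded_bprog Z' V r t I' f'"
  proof unfold_locales
    fix d assume d: "d \<in> edges Z'"
    show "tail (dg Z') d \<in> nodes Z'" "head (dg Z') d \<in> nodes Z'"
      using d uv by (auto simp: sets new tl hd)
    show "head (dg Z') d \<noteq> r"
      using d ne no_arc_to_root[of d] by (auto simp: sets new hd)
    show "tail (dg Z') d \<noteq> t"
      using d ne uv no_arc_from_leaf[of d] by (auto simp: sets new tl split: if_split_asm)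
    show "f' (tail (dg Z') d) < f' (head (dg Z') d)"
      using d ne uv rank[of d] old(1,2)[of d]
      by (auto simp: sets new tl hd f' v_def[symmetric])
    show "I' (tail (dg Z') d) \<subseteq> I' (head (dg Z') d)" if "label Z' d = None"
    proof -
      have dZ: "d \<in> edges Z" using d that by (auto simp: sets new)
      then have "I (tail (dg Z) d) \<subseteq> I (head (dg Z) d)"
        using that by (intro grade_unlabelled) (simp_all add: lb)
      \<comment> \<open>For \<open>d = e\<close> the claim is
        \<open>insert x (I u) \<subseteq> I v\<close>, which holds because x belongs to the grade of
        the head of \<open>e\<close>.\<close>
      then show ?thesis
        using e(3) uv(3) old(1,2)[OF dZ] by (cases "d = e") (simp_all add: tl hd I' dZ e(1) v_def)
    qed
    show "y \<notin> I' (tail (dg Z') d) \<and> I' (head (dg Z') d) = insert y (I' (tail (dg Z') d))"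
      if "label Z' d = Some (y, c)" for y c
    proof (cases "d \<in> edges Z")
      case True
      then have "d \<noteq> e" "label Z d = Some (y, c)" using that e(2) by (auto simp: lb)
      then show ?thesis
        using grade_labelled[OF True, of y c] old(1,2)[OF True] by (simp add: tl hd I' True)
    next
      case False
      then show ?thesis using d that ne e(4) by (auto simp: sets new I')
    qed
  next
    fix z assume z: "z \<in> nodes Z'"
    show "\<exists>d\<in>edges Z'. head (dg Z') d = z" if zr: "z \<noteq> r"
    proof (cases "z = w")
      case False
      then obtain d where "d \<in> edges Z" "head (dg Z) d = z"
        using z zr arc_to_nonroot[of z] by (auto simp: sets)
      then show ?thesis using hd sets by auto
    qed (use new sets in auto)
    \<comment> \<open>Only \<open>u\<close> and \<open>w\<close> need care: \<open>u\<close> loses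
      \<open>e\<close> but gains the new pair, and \<open>w\<close> gets \<open>e\<close>.\<close>
    show "\<exists>d\<in>edges Z'. tail (dg Z') d = z" if zt: "z \<noteq> t"
    proof (cases "z = w \<or> z = u")
      case False
      then obtain d where "d \<in> edges Z" "tail (dg Z) d = z"
        using z zt arc_from_nonleaf[of z] by (auto simp: sets)
      then have "d \<in> edges Z'" "tail (dg Z') d = z"
        using False by (auto simp: tl sets u_def)
      then show ?thesis by blast
    qed (use new sets tl[OF e(1)] e(1) in auto)
    show "I' z \<subseteq> V"
      using z e uv grade_le[of z] grade_le[of u] grade_le[of v] by (auto simp: sets I'_def)
  qed (use root_node leaf_node finite_V grade_root ne in \<open>auto simp: sets I'_def\<close>)
  moreover have "accepts Z' r t \<alpha> \<longleftrightarrow> accepts Z r t \<alpha>" if dom: "dom \<alpha> = V" for \<alpha>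
  proof
    \<comment> \<open>Contracting \<open>w\<close> into \<open>u\<close> makes the new pair vanish
      and gives \<open>e\<close> its old tail back.\<close>
    define \<pi> where "\<pi> z = (if z = w then u else z)" for z
    have "(\<pi> y, \<pi> z) \<in> (open_steps Z \<alpha>)\<^sup>*" if yz: "(y, z) \<in> open_steps Z' \<alpha>" for y z
    proof -
      obtain d where d: "d \<in> edges Z'" "labels Z' {d} \<subseteq> Map.graph \<alpha>"
        "y = tail (dg Z') d" "z = head (dg Z') d"
        using yz by (auto simp: open_steps_def)
      show ?thesis
      proof (cases "d \<in> edges Z")
        case True
        then have "(tail (dg Z) d, head (dg Z) d) \<in> open_steps Z \<alpha>"
          using d lb[OF True] by (auto simp: open_steps_def labels_single)
        moreover have "\<pi> y = tail (dg Z) d" "\<pi> z = head (dg Z) d"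
          using d True old[OF True] by (auto simp: tl hd \<pi>_def u_def)
        ultimately show ?thesis by auto
      next
        case False
        then have "d = a \<or> d = b" using d(1) by (simp add: sets)
        then have "y = u" "z = w" using d(3,4) new by auto
        then show ?thesis using ne by (simp add: \<pi>_def)
      qed
    qed
    note sim = rtrancl_simulation[of _ _ "open_steps Z' \<alpha>" \<pi>, OF _ this]
    assume "accepts Z' r t \<alpha>"
    then have "(\<pi> r, \<pi> t) \<in> (open_steps Z \<alpha>)\<^sup>*"
      unfolding accepts_def by (rule sim)
    then show "accepts Z r t \<alpha>"
      using ne by (simp add: accepts_def \<pi>_def)
  next
    \<comment> \<open>Totality enters here: x lies in V, so \<alpha> gives it a value and agrees
      with one edge of the pair.\<close>
    obtain c where c: "\<alpha> x = Some c"
      using dom e uv grade_le[of v] by auto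
    have uw: "(u, w) \<in> open_steps Z' \<alpha>"
    proof -
      define d where "d = (if c then a else b)"
      have "d \<in> edges Z'" "labels Z' {d} \<subseteq> Map.graph \<alpha>" "tail (dg Z') d = u" "head (dg Z') d = w"
        using c new sets by (auto simp: d_def labels_single Map.graph_def)
      then show ?thesis by (force simp: open_steps_def)
    qed
    have "(y, z) \<in> (open_steps Z' \<alpha>)\<^sup>*" if yz: "(y, z) \<in> open_steps Z \<alpha>" for y z
    proof -
      obtain d where d: "d \<in> edges Z" "labels Z {d} \<subseteq> Map.graph \<alpha>"
        "y = tail (dg Z) d" "z = head (dg Z) d"
        using yz by (auto simp: open_steps_def)
      then have "(tail (dg Z') d, z) \<in> open_steps Z' \<alpha>"
        by (force simp: open_steps_def labels_single lb hd sets)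
      \<comment> \<open>The step along \<open>e\<close> now starts at \<open>w\<close> and is
        preceded by the one from \<open>u\<close> to \<open>w\<close>.\<close>
      then show ?thesis
        using uw d by (cases "d = e") (auto simp: tl u_def intro: converse_rtrancl_into_rtrancl)
    qed
    note sim = rtrancl_simulation[of _ _ "open_steps Z \<alpha>" "\<lambda>z. z", OF _ this]
    assume "accepts Z r t \<alpha>"
    then show "accepts Z' r t \<alpha>"
      using sim unfolding accepts_def by blast
  qed
  moreover have "card (edges Z') = card (edges Z) + 2"
    using a b by (simp add: sets)
  moreover have "gaps Z' I' = gaps Z I - {(e, x)}"
  proof -
    have "(d, y) \<in> gaps Z' I' \<longleftrightarrow> (d, y) \<in> gaps Z I - {(e, x)}" for d y
    proof (cases "d \<in> edges Z")
      case True
      then show ?thesis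
        using old[OF True] e ne by (auto simp: gaps_def sets tl hd lb I' u_def v_def)
    next
      case False
      then show ?thesis using new by (auto simp: gaps_def sets)
    qed
    then show ?thesis by auto
  qed
  moreover have "I' t = I t" using ne by (simp add: I'_def)
  ultimately show thesis by (rule that)
qed

text \<open>The same pair, now leading from the old leaf to a new one. No old edge is redirected and
  the new edges are labelled, so the gaps stay as they are.\<close>

lemma graded_bprog_extend_leaf:
  fixes Z :: "(nat, nat, 'x) bprog"
  assumes "graded_bprog Z V r t I f" and x: "x \<in> V - I t"
  obtains Z' :: "(nat, nat, 'x) bprog" and t' I' f'
  where "graded_bprog Z' V r t' I' f'"
    and "\<And>\<alpha>. dom \<alpha> = V \<Longrightarrow> accepts Z' r t' \<alpha> \<longleftrightarrow> accepts Z r t \<alpha>"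
    and "card (edges Z') = card (edges Z) + 2"
    and "gaps Z' I' = gaps Z I" and "I' t' = insert x (I t)"
proof -
  interpret graded_bprog Z V r t I f by fact
  obtain w where w: "w \<notin> nodes Z"
    using ex_new_if_finite[OF infinite_UNIV_nat finite_verts] by blast
  obtain a where a: "a \<notin> edges Z"
    using ex_new_if_finite[OF infinite_UNIV_nat finite_arcs] by blast
  obtain b where b: "b \<notin> edges Z" "b \<noteq> a"
    using ex_new_if_finite[OF infinite_UNIV_nat, of "insert a (edges Z)"] by auto
  define Z' :: "(nat, nat, 'x) bprog" where
    "Z' = \<lparr>dg = \<lparr>verts = insert w (nodes Z), arcs = insert a (insert b (edges Z)),
        tail = (tail (dg Z))(a := t, b := t), head = (head (dg Z))(a := w, b := w)\<rparr>,
      label = (label Z)(a := Some (x, True), b := Some (x, False))\<rparr>"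
  define I' where "I' = I(w := insert x (I t))"
  define f' where "f' = f(w := f t + 1)"
  have old: "tail (dg Z) d \<noteq> w" "head (dg Z) d \<noteq> w" "d \<noteq> a" "d \<noteq> b" if "d \<in> edges Z" for d
    using that w a b by (auto dest: tail_in_verts head_in_verts)
  have ne: "w \<noteq> r" "w \<noteq> t"
    using w root_node leaf_node by auto
  have tl: "tail (dg Z') d = tail (dg Z) d"
    and hd: "head (dg Z') d = head (dg Z) d"
    and lb: "label Z' d = label Z d" if "d \<in> edges Z" for d
    using old[OF that] by (auto simp: Z'_def)
  have new: "tail (dg Z') a = t" "tail (dg Z') b = t" "head (dg Z') a = w" "head (dg Z') b = w"
    "label Z' a = Some (x, True)" "label Z' b = Some (x, False)"
    using b by (auto simp: Z'_def)
  have sets: "nodes Z' = insert w (nodes Z)" "edges Z' = insert a (insert b (edges Z))"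
    by (auto simp: Z'_def)
  have I': "I' w = insert x (I t)" "\<And>z. z \<noteq> w \<Longrightarrow> I' z = I z"
    and f': "f' w = f t + 1" "\<And>z. z \<noteq> w \<Longrightarrow> f' z = f z"
    by (auto simp: I'_def f'_def)
  have "graded_bprog Z' V r w I' f'"
  proof unfold_locales
    fix d assume d: "d \<in> edges Z'"
    show "tail (dg Z') d \<in> nodes Z'" "head (dg Z') d \<in> nodes Z'"
      using d leaf_node by (auto simp: sets new tl hd)
    show "head (dg Z') d \<noteq> r"
      using d ne no_arc_to_root[of d] by (auto simp: sets new hd)
    show "tail (dg Z') d \<noteq> w"
      using d ne old(1)[of d] by (auto simp: sets new tl)
    show "f' (tail (dg Z') d) < f' (head (dg Z') d)"
      using d ne rank[of d] old(1,2)[of d] by (auto simp: sets new tl hd f')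
    show "I' (tail (dg Z') d) \<subseteq> I' (head (dg Z') d)" if "label Z' d = None"
      using d that ne grade_unlabelled[of d] old(1,2)[of d]
      by (auto simp: sets new tl hd lb I')
    show "y \<notin> I' (tail (dg Z') d) \<and> I' (head (dg Z') d) = insert y (I' (tail (dg Z') d))"
      if "label Z' d = Some (y, c)" for y c
      using d that ne x grade_labelled[of d y c] old(1,2)[of d]
      by (auto simp: sets new tl hd lb I')
  next
    fix z assume z: "z \<in> nodes Z'"
    show "\<exists>d\<in>edges Z'. head (dg Z') d = z" if zr: "z \<noteq> r"
    proof (cases "z = w")
      case False
      then obtain d where "d \<in> edges Z" "head (dg Z) d = z"
        using z zr arc_to_nonroot[of z] by (auto simp: sets)
      then show ?thesis using hd sets by auto
    qed (use new sets in auto)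
    show "\<exists>d\<in>edges Z'. tail (dg Z') d = z" if zw: "z \<noteq> w"
    proof (cases "z = t")
      case False
      then obtain d where "d \<in> edges Z" "tail (dg Z) d = z"
        using z zw False arc_from_nonleaf[of z] by (auto simp: sets)
      then show ?thesis using tl sets by auto
    qed (use new sets in auto)
    show "I' z \<subseteq> V"
      using z x grade_le[of z] grade_le[of t] leaf_node by (auto simp: sets I'_def)
  qed (use root_node finite_V grade_root ne in \<open>auto simp: sets I'_def\<close>)
  moreover have "accepts Z' r w \<alpha> \<longleftrightarrow> accepts Z r t \<alpha>" if dom: "dom \<alpha> = V" for \<alpha>
  proof
    define \<pi> where "\<pi> z = (if z = w then t else z)" for z
    have "(\<pi> y, \<pi> z) \<in> (open_steps Z \<alpha>)\<^sup>*" if yz: "(y, z) \<in> open_steps Z' \<alpha>" for y z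
    proof -
      obtain d where d: "d \<in> edges Z'" "labels Z' {d} \<subseteq> Map.graph \<alpha>"
        "y = tail (dg Z') d" "z = head (dg Z') d"
        using yz by (auto simp: open_steps_def)
      show ?thesis
      proof (cases "d \<in> edges Z")
        case True
        then have "(tail (dg Z) d, head (dg Z) d) \<in> open_steps Z \<alpha>"
          using d lb[OF True] by (auto simp: open_steps_def labels_single)
        moreover have "\<pi> y = tail (dg Z) d" "\<pi> z = head (dg Z) d"
          using d True old[OF True] by (auto simp: tl hd \<pi>_def)
        ultimately show ?thesis by auto
      next
        case False
        then have "d = a \<or> d = b" using d(1) by (simp add: sets)
        then have "y = t" "z = w" using d(3,4) new by auto
        then show ?thesis using ne by (simp add: \<pi>_def)
      qed
    qed
    note sim = rtrancl_simulation[of _ _ "open_steps Z' \<alpha>" \<pi>, OF _ this]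
    assume "accepts Z' r w \<alpha>"
    then have "(\<pi> r, \<pi> w) \<in> (open_steps Z \<alpha>)\<^sup>*"
      unfolding accepts_def by (rule sim)
    then show "accepts Z r t \<alpha>"
      using ne by (simp add: accepts_def \<pi>_def)
  next
    obtain c where c: "\<alpha> x = Some c"
      using dom x by auto
    have tw: "(t, w) \<in> open_steps Z' \<alpha>"
    proof -
      define d where "d = (if c then a else b)"
      have "d \<in> edges Z'" "labels Z' {d} \<subseteq> Map.graph \<alpha>" "tail (dg Z') d = t" "head (dg Z') d = w"
        using c new sets by (auto simp: d_def labels_single Map.graph_def)
      then show ?thesis by (force simp: open_steps_def)
    qed
    \<comment> \<open>The old edges are untouched, so the step relation only grows, and an accepting
      walk is prolonged by the step from \<open>t\<close> to \<open>w\<close>.\<close>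
    have "open_steps Z \<alpha> \<subseteq> open_steps Z' \<alpha>"
    proof (rule subrelI)
      fix y z assume "(y, z) \<in> open_steps Z \<alpha>"
      then obtain d where "d \<in> edges Z" "labels Z {d} \<subseteq> Map.graph \<alpha>"
        "y = tail (dg Z) d" "z = head (dg Z) d"
        by (auto simp: open_steps_def)
      then have "d \<in> edges Z'" "labels Z' {d} \<subseteq> Map.graph \<alpha>"
        "y = tail (dg Z') d" "z = head (dg Z') d"
        by (simp_all add: sets labels_single tl hd lb)
      then show "(y, z) \<in> open_steps Z' \<alpha>" unfolding open_steps_def by blast
    qed
    then have "(open_steps Z \<alpha>)\<^sup>* \<subseteq> (open_steps Z' \<alpha>)\<^sup>*" by (rule rtrancl_mono)
    moreover assume "accepts Z r t \<alpha>"
    ultimately show "accepts Z' r w \<alpha>"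
      using tw unfolding accepts_def by (meson rtrancl.rtrancl_into_rtrancl subsetD)
  qed
  moreover have "card (edges Z') = card (edges Z) + 2"
    using a b by (simp add: sets)
  moreover have "gaps Z' I' = gaps Z I"
  proof -
    have "(d, y) \<in> gaps Z' I' \<longleftrightarrow> (d, y) \<in> gaps Z I" for d y
    proof (cases "d \<in> edges Z")
      case True
      then show ?thesis
        using old[OF True] by (auto simp: gaps_def sets tl hd lb I')
    next
      case False
      then show ?thesis using new by (auto simp: gaps_def sets)
    qed
    then show ?thesis by auto
  qed
  moreover have "I' w = insert x (I t)" by (rule I')
  ultimately show thesis by (rule that)
qed

text \<open>The measure is the number of pairs still to be inserted. Filling a gap preserves the
  grade of the leaf, extending the leaf preserves the gaps, and either lowers the measure by one at
  the price of two edges. Hence the count is exact.\<close>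

lemma graded_bprog_uniformize:
  fixes Z :: "(nat, nat, 'x) bprog"
  assumes "graded_bprog Z V r t I f"
  shows "\<exists>(Z' :: (nat, nat, 'x) bprog) t' I' f'. graded_bprog Z' V r t' I' f' \<and>
    (\<forall>\<alpha>. dom \<alpha> = V \<longrightarrow> accepts Z' r t' \<alpha> = accepts Z r t \<alpha>) \<and>
    gaps Z' I' = {} \<and> I' t' = V \<and>
    card (edges Z') = card (edges Z) + 2 * (card (gaps Z I) + card (V - I t))"
  using assms
proof (induction "card (gaps Z I) + card (V - I t)" arbitrary: Z t I f)
  case 0
  interpret graded_bprog Z V r t I f by fact
  have "gaps Z I = {}" "I t = V"
    using 0(1) finite_gaps finite_V grade_le[OF leaf_node] by auto
  then show ?case using 0 by (intro exI[of _ Z] exI[of _ t] exI[of _ I] exI[of _ f]) auto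
next
  case (Suc d)
  interpret graded_bprog Z V r t I f by fact
  show ?case
  proof (cases "gaps Z I = {}")
    case False
    then obtain e x where ex: "(e, x) \<in> gaps Z I" by auto
    obtain Z1 :: "(nat, nat, 'x) bprog" and I1 f1 where Z1: "graded_bprog Z1 V r t I1 f1"
      "\<And>\<alpha>. dom \<alpha> = V \<Longrightarrow> accepts Z1 r t \<alpha> \<longleftrightarrow> accepts Z r t \<alpha>"
      "card (edges Z1) = card (edges Z) + 2" "gaps Z1 I1 = gaps Z I - {(e, x)}" "I1 t = I t"
      using graded_bprog_fill_gap[OF Suc.prems ex] by metis
    have "card (gaps Z I) = Suc (card (gaps Z1 I1))"
      using Z1(4) ex finite_gaps by (metis card.remove)
    then have *: "card (gaps Z I) + card (V - I t) = Suc (card (gaps Z1 I1) + card (V - I1 t))"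
      using Z1(5) by simp
    then have "d = card (gaps Z1 I1) + card (V - I1 t)" using Suc.hyps(2) by simp
    from Suc.hyps(1)[OF this Z1(1)] show ?thesis
      using Z1(2) unfolding * Z1(3) by (elim exE conjE, intro exI conjI) (assumption | simp)+
  next
    case True
    then have "card (V - I t) \<noteq> 0" using Suc.hyps(2) by simp
    then obtain x where x: "x \<in> V - I t" by (metis card.empty all_not_in_conv)
    obtain Z1 :: "(nat, nat, 'x) bprog" and t1 I1 f1 where Z1: "graded_bprog Z1 V r t1 I1 f1"
      "\<And>\<alpha>. dom \<alpha> = V \<Longrightarrow> accepts Z1 r t1 \<alpha> \<longleftrightarrow> accepts Z r t \<alpha>"
      "card (edges Z1) = card (edges Z) + 2" "gaps Z1 I1 = gaps Z I" "I1 t1 = insert x (I t)"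
      using graded_bprog_extend_leaf[OF Suc.prems x] by metis
    have "V - I t = insert x (V - I1 t1)" "x \<notin> V - I1 t1"
      using Z1(5) x by auto
    then have *: "card (gaps Z I) + card (V - I t) = Suc (card (gaps Z1 I1) + card (V - I1 t1))"
      using Z1(4) finite_V by simp
    then have "d = card (gaps Z1 I1) + card (V - I1 t1)" using Suc.hyps(2) by simp
    from Suc.hyps(1)[OF this Z1(1)] show ?thesis
      using Z1(2) unfolding * Z1(3) by (elim exE conjE, intro exI conjI) (assumption | simp)+
  qed
qed

section \<open>Renaming nodes and edges by natural numbers\<close>

text \<open>The insertions need fresh nodes and edges, which the given types may not offer if they
  are finite. Over \<open>nat\<close> a finite graph always leaves some.\<close>

lemma graded_bprog_relabel_nat:
  fixes Z :: "('v, 'e, 'x) bprog"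
  assumes "graded_bprog Z V r t I f"
  obtains Z' :: "(nat, nat, 'x) bprog" and r' t' I' f'
  where "graded_bprog Z' V r' t' I' f'"
    and "\<And>\<alpha>. accepts Z' r' t' \<alpha> \<longleftrightarrow> accepts Z r t \<alpha>"
    and "card (edges Z') = card (edges Z)"
    and "card (gaps Z' I') = card (gaps Z I)" and "I' t' = I t"
proof -
  interpret graded_bprog Z V r t I f by fact
  obtain g :: "'v \<Rightarrow> nat" where g: "inj_on g (nodes Z)"
    using finite_imp_inj_to_nat_seg[OF finite_verts] by blast
  obtain h :: "'e \<Rightarrow> nat" where h: "inj_on h (edges Z)"
    using finite_imp_inj_to_nat_seg[OF finite_arcs] by blast
  define g' where "g' = inv_into (nodes Z) g"
  define h' where "h' = inv_into (edges Z) h"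
  have g': "g' (g z) = z" if "z \<in> nodes Z" for z
    using that g by (simp add: g'_def)
  have h': "h' (h d) = d" if "d \<in> edges Z" for d
    using that h by (simp add: h'_def)
  define Z' :: "(nat, nat, 'x) bprog" where
    "Z' = \<lparr>dg = \<lparr>verts = g ` nodes Z, arcs = h ` edges Z,
        tail = \<lambda>i. g (tail (dg Z) (h' i)), head = \<lambda>i. g (head (dg Z) (h' i))\<rparr>,
      label = \<lambda>i. label Z (h' i)\<rparr>"
  define I' where "I' = I \<circ> g'"
  define f' where "f' = f \<circ> g'"
  have sets: "nodes Z' = g ` nodes Z" "edges Z' = h ` edges Z"
    by (auto simp: Z'_def)
  have arc: "tail (dg Z') (h d) = g (tail (dg Z) d)" "head (dg Z') (h d) = g (head (dg Z) d)"
    "label Z' (h d) = label Z d" if "d \<in> edges Z" for d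
    using h'[OF that] by (auto simp: Z'_def)
  have I': "I' (g z) = I z" and f': "f' (g z) = f z" if "z \<in> nodes Z" for z
    using g'[OF that] by (auto simp: I'_def f'_def)
  have "graded_bprog Z' V (g r) (g t) I' f'"
  proof unfold_locales
    fix i assume "i \<in> edges Z'"
    then obtain d where d: "d \<in> edges Z" "i = h d" by (auto simp: sets)
    note ends = tail_in_verts[OF d(1)] head_in_verts[OF d(1)]
    show "tail (dg Z') i \<in> nodes Z'" "head (dg Z') i \<in> nodes Z'"
      using ends by (auto simp: d arc sets)
    show "head (dg Z') i \<noteq> g r"
      using no_arc_to_root[OF d(1)] ends root_node g by (auto simp: d arc inj_on_eq_iff)
    show "tail (dg Z') i \<noteq> g t"
      using no_arc_from_leaf[OF d(1)] ends leaf_node g by (auto simp: d arc inj_on_eq_iff)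
    show "f' (tail (dg Z') i) < f' (head (dg Z') i)"
      using rank[OF d(1)] ends by (simp add: d arc f')
    show "I' (tail (dg Z') i) \<subseteq> I' (head (dg Z') i)" if "label Z' i = None"
      using that grade_unlabelled[OF d(1)] ends by (simp add: d arc I')
    show "y \<notin> I' (tail (dg Z') i) \<and> I' (head (dg Z') i) = insert y (I' (tail (dg Z') i))"
      if "label Z' i = Some (y, c)" for y c
      using that grade_labelled[OF d(1)] ends by (simp add: d arc I')
  next
    fix i assume "i \<in> nodes Z'"
    then obtain z where z: "z \<in> nodes Z" "i = g z" by (auto simp: sets)
    show "\<exists>d\<in>edges Z'. head (dg Z') d = i" if "i \<noteq> g r"
      using arc_to_nonroot[OF z(1)] that arc z by (auto simp: sets)
    show "\<exists>d\<in>edges Z'. tail (dg Z') d = i" if "i \<noteq> g t"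
      using arc_from_nonleaf[OF z(1)] that arc z by (auto simp: sets)
    show "I' i \<subseteq> V" using grade_le[OF z(1)] z by (simp add: I')
  qed (use root_node leaf_node finite_V in \<open>auto simp: sets I' grade_root\<close>)
  moreover have "accepts Z' (g r) (g t) \<alpha> \<longleftrightarrow> accepts Z r t \<alpha>" for \<alpha>
  proof
    have "(g' y, g' z) \<in> (open_steps Z \<alpha>)\<^sup>*" if "(y, z) \<in> open_steps Z' \<alpha>" for y z
      using that arc g' tail_in_verts head_in_verts
      by (fastforce simp: open_steps_def sets labels_single)
    note sim = rtrancl_simulation[of _ _ "open_steps Z' \<alpha>" g', OF _ this]
    assume "accepts Z' (g r) (g t) \<alpha>"
    then show "accepts Z r t \<alpha>"
      using sim g' root_node leaf_node unfolding accepts_def by metis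
  next
    have "(g y, g z) \<in> (open_steps Z' \<alpha>)\<^sup>*" if yz: "(y, z) \<in> open_steps Z \<alpha>" for y z
    proof -
      obtain d where "d \<in> edges Z" "labels Z {d} \<subseteq> Map.graph \<alpha>"
        "y = tail (dg Z) d" "z = head (dg Z) d"
        using yz by (auto simp: open_steps_def)
      then have "h d \<in> edges Z'" "labels Z' {h d} \<subseteq> Map.graph \<alpha>"
        "g y = tail (dg Z') (h d)" "g z = head (dg Z') (h d)"
        by (auto simp: sets arc labels_single)
      then show ?thesis unfolding open_steps_def by blast
    qed
    note sim = rtrancl_simulation[of _ _ "open_steps Z \<alpha>" g, OF _ this]
    assume "accepts Z r t \<alpha>"
    then show "accepts Z' (g r) (g t) \<alpha>"
      using sim unfolding accepts_def by metis
  qed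
  moreover have "card (edges Z') = card (edges Z)"
    using h by (simp add: sets card_image)
  moreover have "card (gaps Z' I') = card (gaps Z I)"
  proof -
    have "bij_betw (map_prod h id) (gaps Z I) (gaps Z' I')"
      unfolding bij_betw_def
    proof
      show "inj_on (map_prod h id) (gaps Z I)"
        using h by (auto simp: inj_on_def gaps_def)
      show "map_prod h id ` gaps Z I = gaps Z' I'"
        by (force simp: gaps_def sets arc I' image_iff)
    qed
    then show ?thesis by (metis bij_betw_same_card)
  qed
  moreover have "I' (g t) = I t" using leaf_node by (simp add: I')
  ultimately show thesis by (rule that)
qed

section \<open>Grading a clean NROBP by \<open>IVar\<close>\<close>

locale clean_nrobp = fin_digraph "dg Z"
  for Z :: "('v, 'e, 'x) bprog" +
  fixes V :: "'x set"
  assumes finite_V: "finite V" and is_nrobp: "nrobp V Z" and is_clean: "clean Z"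
begin

lemma acyclic_walks: "\<nexists>c. cycle c"
  using is_nrobp by (simp add: nrobp_def)

lemma path_iff: "path Z u p v \<longleftrightarrow> awalk u p v"
  by (rule apath_iff_awalk_of_acyclic[OF acyclic_walks])

text \<open>Being finite as well, the edge relation is well-founded in both directions, which drives
  the inductions that reach the root and the leaf.\<close>

lemma acyclic_arcs_ends: "acyclic (arcs_ends (dg Z))"
  using acyclic_walks closed_w_imp_cycle
  by (fastforce simp: acyclic_def reachable1_awalk closed_w_def)

lemma finite_arcs_ends: "finite (arcs_ends (dg Z))"
  by (simp add: arcs_ends_def)

lemma is_root_root: "is_root Z v \<longleftrightarrow> v = root Z"
  using is_nrobp unfolding nrobp_def root_def by (metis theI')

lemma is_leaf_leaf: "is_leaf Z v \<longleftrightarrow> v = leaf Z"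
  using is_nrobp unfolding nrobp_def leaf_def by (metis theI')

lemma root_iff: "v = root Z \<longleftrightarrow> v \<in> nodes Z \<and> (\<forall>e\<in>edges Z. head (dg Z) e \<noteq> v)"
  using is_root_root is_root_iff[OF fin_digraph_axioms] by metis

lemma leaf_iff: "v = leaf Z \<longleftrightarrow> v \<in> nodes Z \<and> (\<forall>e\<in>edges Z. tail (dg Z) e \<noteq> v)"
  using is_leaf_leaf is_leaf_iff[OF fin_digraph_axioms] by metis

text \<open>Every node other than the root has an incoming edge, and going backwards along edges
  must end.\<close>

lemma awalk_from_root: "v \<in> nodes Z \<Longrightarrow> \<exists>p. awalk (root Z) p v"
proof (induction v rule: wf_induct_rule[OF finite_acyclic_wf[OF finite_arcs_ends acyclic_arcs_ends]])
  case (1 v)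
  show ?case
  proof (cases "v = root Z")
    case True
    then show ?thesis using 1 by (intro exI[of _ "[]"]) (simp add: awalk_Nil_iff)
  next
    case False
    then obtain e where e: "e \<in> edges Z" "head (dg Z) e = v"
      using root_iff 1 by blast
    then obtain p where "awalk (root Z) p (tail (dg Z) e)"
      using 1(1)[of "tail (dg Z) e"] by (auto simp: arcs_ends_def arc_to_ends_def)
    then have "awalk (root Z) (p @ [e]) v"
      using e by (intro awalk_appendI[of _ p "tail (dg Z) e"]) (auto simp: awalk_simps)
    then show ?thesis by blast
  qed
qed

lemma awalk_to_leaf: "v \<in> nodes Z \<Longrightarrow> \<exists>p. awalk v p (leaf Z)"
proof (induction v rule:
    wf_induct_rule[OF finite_acyclic_wf_converse[OF finite_arcs_ends acyclic_arcs_ends]])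
  case (1 v)
  show ?case
  proof (cases "v = leaf Z")
    case True
    then show ?thesis using 1 by (intro exI[of _ "[]"]) (simp add: awalk_Nil_iff)
  next
    case False
    then obtain e where e: "e \<in> edges Z" "tail (dg Z) e = v"
      using leaf_iff 1 by blast
    then obtain p where "awalk (head (dg Z) e) p (leaf Z)"
      using 1(1)[of "head (dg Z) e"] by (auto simp: arcs_ends_def arc_to_ends_def)
    then have "awalk v (e # p) (leaf Z)"
      using e by (simp add: awalk_Cons_iff)
    then show ?thesis by blast
  qed
qed

lemma IVar_iff: "x \<in> IVar Z v \<longleftrightarrow> (\<exists>p. awalk (root Z) p v \<and> x \<in> label_vars Z (set p))"
  by (simp add: IVar_def path_iff)

lemma IVar_arc_superset:
  assumes e: "e \<in> edges Z"
  shows "IVar Z (tail (dg Z) e) \<union> label_vars Z {e} \<subseteq> IVar Z (head (dg Z) e)"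
proof -
  have ext: "awalk (root Z) (p @ [e]) (head (dg Z) e)" if "awalk (root Z) p (tail (dg Z) e)" for p
    using that e by (intro awalk_appendI[of _ p "tail (dg Z) e"]) (auto simp: awalk_simps)
  have lv: "label_vars Z (set (p @ [e])) = label_vars Z (set p) \<union> label_vars Z {e}" for p
    using label_vars_Un[of Z "set p" "{e}"] by simp
  \<comment> \<open>The label of \<open>e\<close> counts for its head only if some walk from the
    root reaches the tail at all.\<close>
  obtain p0 where p0: "awalk (root Z) p0 (tail (dg Z) e)"
    using awalk_from_root[OF tail_in_verts[OF e]] by blast
  show ?thesis
  proof
    fix x assume "x \<in> IVar Z (tail (dg Z) e) \<union> label_vars Z {e}"
    then obtain p where "awalk (root Z) p (tail (dg Z) e)" "x \<in> label_vars Z (set (p @ [e]))"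
      using p0 unfolding IVar_iff Un_iff lv by blast
    then show "x \<in> IVar Z (head (dg Z) e)" using ext unfolding IVar_iff by blast
  qed
qed

lemma IVar_mono_awalk: "awalk u p v \<Longrightarrow> IVar Z u \<subseteq> IVar Z v"
proof (induction p arbitrary: u)
  case (Cons e p)
  then show ?case
    using IVar_arc_superset[of e] by (auto simp: awalk_Cons_iff)
qed (simp add: awalk_Nil_iff)

lemma IVar_le_leaf: "v \<in> nodes Z \<Longrightarrow> IVar Z v \<subseteq> IVar Z (leaf Z)"
  using awalk_to_leaf IVar_mono_awalk by blast

text \<open>For the case without irregular edges: if every variable of V labels some edge, nothing
  has to be appended to the leaf.\<close>

lemma label_vars_edges_le_leaf: "label_vars Z (edges Z) \<subseteq> IVar Z (leaf Z)"
proof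
  fix x assume "x \<in> label_vars Z (edges Z)"
  then obtain e where e: "e \<in> edges Z" "x \<in> label_vars Z {e}"
    by (auto simp: label_vars_def labels_def)
  then show "x \<in> IVar Z (leaf Z)"
    using IVar_arc_superset[OF e(1)] IVar_le_leaf[OF head_in_verts[OF e(1)]] by blast
qed

lemma IVar_le: "IVar Z v \<subseteq> V"
proof -
  have "label_vars Z (set p) \<subseteq> V" if "awalk u p v" for u p
  proof -
    have "set p \<subseteq> edges Z" using that by (simp add: awalk_def)
    then have "label_vars Z (set p) \<subseteq> label_vars Z (edges Z)"
      by (auto simp: label_vars_def labels_def)
    then show ?thesis using is_nrobp by (auto simp: nrobp_def)
  qed
  then show ?thesis unfolding IVar_iff subset_iff by blast
qed

text \<open>If no other edge enters the head, every walk from the root to it that reads a variable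
  ends with \<open>e\<close>.\<close>

lemma IVar_arc_unique:
  assumes e: "e \<in> edges Z" and deg: "\<not> in_degree (dg Z) (head (dg Z) e) > 1"
  shows "IVar Z (head (dg Z) e) = IVar Z (tail (dg Z) e) \<union> label_vars Z {e}"
proof
  have uniq: "d = e" if "d \<in> edges Z" "head (dg Z) d = head (dg Z) e" for d
  proof -
    have "d \<in> in_arcs (dg Z) (head (dg Z) e)" "e \<in> in_arcs (dg Z) (head (dg Z) e)"
      using that e by (auto simp: in_arcs_def)
    then show ?thesis
      using deg finite_in_arcs by (simp add: in_degree_def not_less card_le_Suc0_iff_eq)
  qed
  show "IVar Z (head (dg Z) e) \<subseteq> IVar Z (tail (dg Z) e) \<union> label_vars Z {e}"
  proof
    fix x assume "x \<in> IVar Z (head (dg Z) e)"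
    then obtain p where p: "awalk (root Z) p (head (dg Z) e)" "x \<in> label_vars Z (set p)"
      by (auto simp: IVar_iff)
    then have "p \<noteq> []" by auto
    then obtain q d where pq: "p = q @ [d]" by (cases p rule: rev_cases) auto
    then have "awalk (root Z) q (tail (dg Z) d)" "d \<in> edges Z" "head (dg Z) d = head (dg Z) e"
      using p(1) by (auto simp: awalk_simps)
    moreover from this have "d = e" by (intro uniq)
    moreover have "label_vars Z (set p) = label_vars Z (set q) \<union> label_vars Z {d}"
      using label_vars_Un[of Z "set q" "{d}"] by (simp add: pq)
    ultimately show "x \<in> IVar Z (tail (dg Z) e) \<union> label_vars Z {e}"
      using p(2) by (auto simp: IVar_iff)
  qed
qed (rule IVar_arc_superset[OF e])

text \<open>A walk from the root that reads x before reaching the tail would, prolonged by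
  \<open>e\<close>, read x twice.\<close>

lemma label_notin_IVar:
  assumes e: "e \<in> edges Z" and lab: "label Z e = Some (x, b)"
  shows "x \<notin> IVar Z (tail (dg Z) e)"
proof
  assume "x \<in> IVar Z (tail (dg Z) e)"
  then obtain p d c where p: "awalk (root Z) p (tail (dg Z) e)"
    and d: "d \<in> set p" "label Z d = Some (x, c)"
    by (auto simp: IVar_iff label_vars_def labels_def)
  have pe: "awalk (root Z) (p @ [e]) (head (dg Z) e)"
    using p e by (intro awalk_appendI[of _ p "tail (dg Z) e"]) (auto simp: awalk_simps)
  \<comment> \<open>\<open>read_once\<close> only identifies the two edges; the contradiction is
    that a path cannot repeat an edge.\<close>
  then have "distinct (p @ [e])"
    using path_iff by (metis apath_def distinct_tl distinct_tl_verts_imp_distinct)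
  moreover have "d = e"
  proof -
    have "read_once Z" using is_nrobp by (simp add: nrobp_def)
    then show ?thesis
      using pe d lab unfolding read_once_def path_iff
      by (metis Un_iff list.set_intros(1) set_append)
  qed
  ultimately show False using d by simp
qed

lemma label_None_of_relevant:
  "e \<in> edges Z \<Longrightarrow> in_degree (dg Z) (head (dg Z) e) > 1 \<Longrightarrow> label Z e = None"
  using is_clean by (auto simp: clean_def in_arcs_def)

text \<open>By cleanness a labelled edge is the only one entering its head, so the head gains
  exactly its variable, which read-once keeps out of the tail. The rank of a node is its number of
  proper ancestors.\<close>

lemma graded_bprog_IVar:
  "graded_bprog Z V (root Z) (leaf Z) (IVar Z)
     (\<lambda>v. real (card {u. (u, v) \<in> (arcs_ends (dg Z))\<^sup>+}))"
proof unfold_locales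
  show "finite V" by (rule finite_V)
  show "root Z \<in> nodes Z" "leaf Z \<in> nodes Z" using root_iff leaf_iff by blast+
  show "IVar Z (root Z) = {}"
  proof -
    have "p = []" if "awalk (root Z) p (root Z)" for p
      using that acyclic_walks closed_w_imp_cycle by (auto simp: closed_w_def)
    then show ?thesis unfolding set_eq_iff IVar_iff by force
  qed
next
  fix v assume "v \<in> nodes Z"
  show "v \<noteq> root Z \<Longrightarrow> \<exists>e\<in>edges Z. head (dg Z) e = v"
    and "v \<noteq> leaf Z \<Longrightarrow> \<exists>e\<in>edges Z. tail (dg Z) e = v"
    using \<open>v \<in> nodes Z\<close> root_iff leaf_iff by blast+
  show "IVar Z v \<subseteq> V" by (rule IVar_le)
next
  fix e assume e: "e \<in> edges Z"
  show "head (dg Z) e \<noteq> root Z" "tail (dg Z) e \<noteq> leaf Z"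
    using e root_iff leaf_iff by blast+
  let ?R = "arcs_ends (dg Z)"
  have te: "(tail (dg Z) e, head (dg Z) e) \<in> ?R"
    using e by (auto simp: arcs_ends_def arc_to_ends_def)
  have "{u. (u, tail (dg Z) e) \<in> ?R\<^sup>+} \<subset> {u. (u, head (dg Z) e) \<in> ?R\<^sup>+}"
  proof
    show "{u. (u, tail (dg Z) e) \<in> ?R\<^sup>+} \<subseteq> {u. (u, head (dg Z) e) \<in> ?R\<^sup>+}"
      using te by (auto intro: trancl_into_trancl)
    \<comment> \<open>The tail is an ancestor of the head but, by acyclicity, not of itself.\<close>
    show "{u. (u, tail (dg Z) e) \<in> ?R\<^sup>+} \<noteq> {u. (u, head (dg Z) e) \<in> ?R\<^sup>+}"
      using te acyclic_arcs_ends unfolding acyclic_def by blast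
  qed
  moreover have "finite {u. (u, head (dg Z) e) \<in> ?R\<^sup>+}"
  proof (rule finite_subset)
    show "{u. (u, head (dg Z) e) \<in> ?R\<^sup>+} \<subseteq> Domain ?R"
      by (auto dest: tranclD)
    show "finite (Domain ?R)" using finite_arcs_ends by (rule finite_Domain)
  qed
  ultimately show "real (card {u. (u, tail (dg Z) e) \<in> ?R\<^sup>+})
      < real (card {u. (u, head (dg Z) e) \<in> ?R\<^sup>+})"
    by (simp add: psubset_card_mono)
  show "IVar Z (tail (dg Z) e) \<subseteq> IVar Z (head (dg Z) e)"
    using IVar_arc_superset[OF e] by blast
  show "x \<notin> IVar Z (tail (dg Z) e) \<and>
      IVar Z (head (dg Z) e) = insert x (IVar Z (tail (dg Z) e))"
    if "label Z e = Some (x, b)" for x b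
    using that IVar_arc_unique[OF e] label_notin_IVar[OF e that] label_None_of_relevant[OF e]
    by (auto simp: label_vars_single)
qed

text \<open>A sole incoming edge without a label passes \<open>IVar\<close> on unchanged, so a gap
  forces in-degree above 1 and a strict inclusion. Bounding the variables by \<open>IVar\<close> of
  the leaf instead of V leaves room in the budget for those appended at the leaf.\<close>

lemma gaps_IVar_subset: "gaps Z (IVar Z) \<subseteq> {e. irregular Z e} \<times> IVar Z (leaf Z)"
proof (rule subrelI)
  fix e x assume "(e, x) \<in> gaps Z (IVar Z)"
  then have e: "e \<in> edges Z" "label Z e = None"
    and x: "x \<in> IVar Z (head (dg Z) e)" "x \<notin> IVar Z (tail (dg Z) e)"
    by (auto simp: gaps_def)
  have "in_degree (dg Z) (head (dg Z) e) > 1"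
    using IVar_arc_unique[OF e(1)] e x by (auto simp: label_vars_single)
  then have "irregular Z e"
    using e x IVar_arc_superset[OF e(1)] by (auto simp: irregular_def relevant_def)
  then show "(e, x) \<in> {e. irregular Z e} \<times> IVar Z (leaf Z)"
    using x IVar_le_leaf[OF head_in_verts[OF e(1)]] by blast
qed

lemma card_gaps_IVar:
  assumes "{e. irregular Z e} = {} \<Longrightarrow> V \<subseteq> label_vars Z (edges Z)"
  shows "card (gaps Z (IVar Z)) + card (V - IVar Z (leaf Z)) \<le> card {e. irregular Z e} * card V"
proof -
  let ?q = "card {e. irregular Z e}" and ?I = "IVar Z (leaf Z)"
  have fin: "finite {e. irregular Z e}"
    by (rule finite_subset[OF _ finite_arcs]) (auto simp: irregular_def relevant_def)
  have finI: "finite ?I" using IVar_le finite_V by (rule finite_subset)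
  have "card (gaps Z (IVar Z)) \<le> ?q * card ?I"
    using card_mono[OF _ gaps_IVar_subset] fin finI by (simp add: card_cartesian_product)
  moreover have "card (V - ?I) \<le> ?q * card (V - ?I)"
  proof (cases "?q = 0")
    case True
    \<comment> \<open>\<open>fin\<close> rules out that \<open>card\<close> is 0 because the set is
      infinite.\<close>
    then have "V - ?I = {}" using fin assms label_vars_edges_le_leaf by auto
    then show ?thesis by (simp only: card.empty)
  next
    case False
    then show ?thesis by (metis One_nat_def Suc_leI mult_1 mult_le_mono1 neq0_conv)
  qed
  ultimately have "card (gaps Z (IVar Z)) + card (V - ?I) \<le> ?q * (card ?I + card (V - ?I))"
    unfolding distrib_left by (rule add_mono)
  also have "card ?I + card (V - ?I) = card V"
    using card_Diff_subset[OF finI IVar_le] card_mono[OF finite_V IVar_le] by simp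
  finally show ?thesis .
qed

end

text \<open>The last hypothesis excludes cases such as a single node computing the constant true
  function on one variable: there \<open>q = 0\<close>, and a program without edges cannot read that
  variable.\<close>

theorem theorem6:
  fixes Z :: "('v, 'e, 'x) bprog"
    and V :: "'x set"
    and F :: "('x \<rightharpoonup> bool) \<Rightarrow> bool"
    and n q :: nat
  assumes "finite V" and "card V = n"
    and "nrobp V Z" and "computes Z V F" and "clean Z"
    and "card {e. irregular Z e} = q"
    and "q = 0 \<Longrightarrow> V \<subseteq> label_vars Z (edges Z)"
  shows "\<exists>Z' :: (nat, nat, 'x) bprog.
           nrobp V Z' \<and> computes Z' V F \<and> uniform V Z' \<and>
           card (edges Z') \<le> card (edges Z) + 2 * q * n"
proof -
  interpret fin_digraph "dg Z" using assms(3) by (simp add: nrobp_def)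
  interpret clean_nrobp Z V using assms by unfold_locales
  obtain f where Z: "graded_bprog Z V (root Z) (leaf Z) (IVar Z) f"
    using graded_bprog_IVar by blast
  obtain Z0 :: "(nat, nat, 'x) bprog" and r t I f0 where Z0: "graded_bprog Z0 V r t I f0"
    "\<And>\<alpha>. accepts Z0 r t \<alpha> \<longleftrightarrow> accepts Z (root Z) (leaf Z) \<alpha>"
    "card (edges Z0) = card (edges Z)" "card (gaps Z0 I) = card (gaps Z (IVar Z))"
    "I t = IVar Z (leaf Z)"
    using graded_bprog_relabel_nat[OF Z] by metis
  obtain Z1 :: "(nat, nat, 'x) bprog" and t1 I1 f1 where Z1: "graded_bprog Z1 V r t1 I1 f1"
    "\<And>\<alpha>. dom \<alpha> = V \<Longrightarrow> accepts Z1 r t1 \<alpha> = accepts Z0 r t \<alpha>"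
    "gaps Z1 I1 = {}" "I1 t1 = V"
    "card (edges Z1) = card (edges Z0) + 2 * (card (gaps Z0 I) + card (V - I t))"
    using graded_bprog_uniformize[OF Z0(1)] by blast
  have "card (gaps Z0 I) + card (V - I t) \<le> q * n"
    using card_gaps_IVar assms(2,6,7) Z0(4,5) by fastforce
  then have "card (edges Z1) \<le> card (edges Z) + 2 * q * n"
    using Z0(3) Z1(5) by simp
  \<comment> \<open>Both sides are acceptance statements for assignments with domain V, on which
    \<open>Z\<close>, \<open>Z0\<close> and \<open>Z1\<close> agree.\<close>
  moreover have "computes Z1 V F"
    using assms(4) Z0(2) Z1(2)
    unfolding graded_bprog.computes_iff[OF Z] graded_bprog.computes_iff[OF Z1(1)] by simp
  ultimately show ?thesis
    using graded_bprog.nrobp[OF Z1(1)] graded_bprog.uniform[OF Z1(1,3,4)] by blast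
qed

end
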